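(* Let $\Sigma^2=(\Sigma^2_0,\Sigma^2_1,\Sigma^2_2)$ be a simply connected quadrilateral cell complex. Any Darboux pair $\langle h^+\rangle,\langle h^-\rangle:\Sigma^2_0\to\mathbb{C}P^1$ of discrete holomorphic maps into the $2$-sphere $S^2\cong\mathbb{C}P^1$ admits a Weierstrass representation. That is, there exist a discrete holomorphic function $g:\Sigma^2_0\to\mathbb{C}$ with edge-labelling $a:\Sigma^2_1\to\mathbb{R}$, a real number $t\in\mathbb{R}\setminus\{0,\frac{1}{a_{ij}}\mid (ij)\in\Sigma^2_1\}$, and lifts $h^\pm:\Sigma^2_0\to\mathbb{C}^2$ of the two holomorphic maps $\langle h^\pm\rangle$, such that $F:=(h^+,h^-)$ (the matrix with columns $h^+,h^-$) takes values in $\mathrm{Sl}(2,\mathbb{C})$ and satisfies, for every edge $(ij)\in\Sigma^2_1$, $$F_j=F_iW_{ij}\quad\text{with}\quad W_{ij}:=\frac{1}{\sqrt{1-ta_{ij}}}\begin{pmatrix}1 & dg_{ij}\\ \frac{ta_{ij}}{dg_{ij}} & 1\end{pmatrix}.$$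
   Context: A quadrilateral cell complex $\Sigma^2=(\Sigma^2_0,\Sigma^2_1,\Sigma^2_2)$ consists of vertices $i\in\Sigma^2_0$, oriented edges $(ij)\in\Sigma^2_1$ from $i$ to $j$ (with $(ji)$ the reversed edge), and oriented quadrilateral faces $(ijkl)\in\Sigma^2_2$ with edges $(ij),(jk),(kl),(li)\in\Sigma^2_1$. It is simply connected if any two vertices can be joined by an edge path and every closed edge path is null-homotopic via face-flips (replacing part of the boundary of a face by the complementary part) and via dropping single-edge return trips. For a function $g$ on vertices, $dg_{ij}:=g_j-g_i$. An edge-labelling is a function $a:\Sigma^2_1\to\mathbb{R}$ with $a_{ij}=a_{ji}$ for every edge $(ij)$ and $a_{ij}=a_{kl}$ for every face $(ijkl)$. Cross ratio: for points of $\mathbb{C}P^1$ with homogeneous coordinates $x_1,\dots,x_4\in\mathbb{C}^2\setminus\{0\}$, $$\mathrm{cr}(\langle x_1\rangle,\langle x_2\rangle,\langle x_3\rangle,\langle x_4\rangle)=\frac{\det(x_1,x_2)}{\det(x_2,x_3)}\frac{\det(x_3,x_4)}{\det(x_4,x_1)};$$ for a function $g:\Sigma^2_0\to\mathbb{C}$ this reads $\mathrm{cr}(g_i,g_j,g_k,g_l)=\frac{dg_{ij}}{dg_{jk}}\frac{dg_{kl}}{dg_{li}}$. A function $g:\Sigma^2_0\to\mathbb{C}$ (or a map into $\mathbb{C}P^1$) is discrete holomorphic with edge-labelling $a$ if $\mathrm{cr}(g_i,g_j,g_k,g_l)=\frac{a_{ij}}{a_{jk}}$ for every face $(ijkl)\in\Sigma^2_2$,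 where these face cross ratios are assumed to be different from $0,1,\infty$ (regularity). Two discrete holomorphic maps $\langle h^\pm\rangle:\Sigma^2_0\to\mathbb{C}P^1$ form a Darboux pair if there are a parameter $\tau\in\mathbb{R}\setminus\{0\}$ and an edge-labelling $b:\Sigma^2_1\to\mathbb{R}$ such that $$\mathrm{cr}(\langle h^\pm_i\rangle,\langle h^\pm_j\rangle,\langle h^\pm_k\rangle,\langle h^\pm_l\rangle)=\frac{b_{ij}}{b_{jk}}\ \text{ for all }(ijkl)\in\Sigma^2_2,\qquad \mathrm{cr}(\langle h^+_i\rangle,\langle h^+_j\rangle,\langle h^-_j\rangle,\langle h^-_i\rangle)=\tau b_{ij}\ \text{ for all }(ij)\in\Sigma^2_1.$$ A lift of $\langle h\rangle:\Sigma^2_0\to\mathbb{C}P^1$ is a map $h:\Sigma^2_0\to\mathbb{C}^2\setminus\{0\}$ such that $h_i$ spans $\langle h\rangle_i$. The square root of a real number is the principal one ($\sqrt{x}=\mathrm{i}\sqrt{|x|}$ for $x<0$).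
   Formalization: The regularity condition is also imposed on the edge cross ratios of the Darboux pair, so τb_ij is not 0 or 1 (for τb_ij = 1 a diagonal entry of the transition matrix vanishes and the claim fails), and the complex has no isolated vertices, which excludes the one-point complex. *)

theory Defs
  imports "HOL-Analysis.Analysis"
begin

section \<open>Quadrilateral cell complexes\<close>

record 'v quad_complex =
  verts :: "'v set"
  edges :: "('v \<times> 'v) set"
  faces :: "('v \<times> 'v \<times> 'v \<times> 'v) set"

text \<open>The tuples \<open>(i,j,k,l)\<close> and \<open>(j,k,l,i)\<close> denote the same oriented face, so \<open>faces\<close> contains
  both; a condition imposed on ``every face'' thus holds for every choice of the initial vertex.
  The last condition excludes isolated vertices (for a connected complex, it only
  excludes the complex that consists of a single point).\<close>

definition quad_cell_complex :: "'v quad_complex \<Rightarrow> bool" where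
  "quad_cell_complex S \<longleftrightarrow>
     (\<forall>i j. (i, j) \<in> edges S \<longrightarrow> i \<in> verts S \<and> j \<in> verts S \<and> (j, i) \<in> edges S) \<and>
     (\<forall>i j k l. (i, j, k, l) \<in> faces S \<longrightarrow>
        (i, j) \<in> edges S \<and> (j, k) \<in> edges S \<and> (k, l) \<in> edges S \<and> (l, i) \<in> edges S \<and>
        (j, k, l, i) \<in> faces S) \<and>
     (\<forall>i \<in> verts S. \<exists>j. (i, j) \<in> edges S)"

definition edge_path :: "'v quad_complex \<Rightarrow> 'v list \<Rightarrow> bool" where
  "edge_path S p \<longleftrightarrow> p \<noteq> [] \<and> set p \<subseteq> verts S \<and>
     (\<forall>n. Suc n < length p \<longrightarrow> (p ! n, p ! Suc n) \<in> edges S)"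

text \<open>Two paths along the boundary of a face \<open>(i,j,k,l)\<close> with the same ends are complementary: they
  consist of 1 and 3, or of 2 and 2, or of 3 and 1 edges. Moves in the opposite direction are
  supplied by the equivalence closure below.\<close>

inductive path_move :: "'v quad_complex \<Rightarrow> 'v list \<Rightarrow> 'v list \<Rightarrow> bool" for S where
  drop_return: "(i, j) \<in> edges S \<Longrightarrow> path_move S (us @ [i, j, i] @ vs) (us @ [i] @ vs)"
| flip_1_3: "(i, j, k, l) \<in> faces S \<Longrightarrow>
    path_move S (us @ [i, j] @ vs) (us @ [i, l, k, j] @ vs)"
| flip_2_2: "(i, j, k, l) \<in> faces S \<Longrightarrow>
    path_move S (us @ [i, j, k] @ vs) (us @ [i, l, k] @ vs)"
| flip_3_1: "(i, j, k, l) \<in> faces S \<Longrightarrow>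
    path_move S (us @ [i, j, k, l] @ vs) (us @ [i, l] @ vs)"

definition path_homotopic :: "'v quad_complex \<Rightarrow> 'v list \<Rightarrow> 'v list \<Rightarrow> bool" where
  "path_homotopic S = equivclp (path_move S)"

definition simply_connected_complex :: "'v quad_complex \<Rightarrow> bool" where
  "simply_connected_complex S \<longleftrightarrow>
     (\<forall>i \<in> verts S. \<forall>j \<in> verts S. \<exists>p. edge_path S p \<and> hd p = i \<and> last p = j) \<and>
     (\<forall>p. edge_path S p \<and> hd p = last p \<longrightarrow> path_homotopic S p [hd p])"

definition edge_labelling :: "'v quad_complex \<Rightarrow> ('v \<Rightarrow> 'v \<Rightarrow> real) \<Rightarrow> bool" where
  "edge_labelling S a \<longleftrightarrow>
     (\<forall>i j. (i, j) \<in> edges S \<longrightarrow> a i j = a j i) \<and>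
     (\<forall>i j k l. (i, j, k, l) \<in> faces S \<longrightarrow> a i j = a k l)"


section \<open>The complex projective line and cross ratios\<close>

definition CP1 :: "(complex^2) set set" where
  "CP1 = {L. \<exists>x. x \<noteq> 0 \<and> L = vec.span {x}}"

definition columns2 :: "complex^2 \<Rightarrow> complex^2 \<Rightarrow> complex^2^2" where
  "columns2 x y = transpose (vector [x, y])"

text \<open>\<open>has_cr L\<^sub>1 L\<^sub>2 L\<^sub>3 L\<^sub>4 q\<close>: the cross ratio is well defined, finite, and equal to \<open>q\<close>.
  The conditions on the denominators exclude the value \<open>\<infinity>\<close> and the undefined
  cases, which division by zero would otherwise turn into the value 0.\<close>

definition has_cr ::
  "(complex^2) set \<Rightarrow> (complex^2) set \<Rightarrow> (complex^2) set \<Rightarrow> (complex^2) set \<Rightarrow> complex \<Rightarrow> bool" where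
  "has_cr L1 L2 L3 L4 q \<longleftrightarrow>
     (\<exists>x1 x2 x3 x4. x1 \<noteq> 0 \<and> x2 \<noteq> 0 \<and> x3 \<noteq> 0 \<and> x4 \<noteq> 0 \<and>
        L1 = vec.span {x1} \<and> L2 = vec.span {x2} \<and> L3 = vec.span {x3} \<and> L4 = vec.span {x4} \<and>
        det (columns2 x2 x3) \<noteq> 0 \<and> det (columns2 x4 x1) \<noteq> 0 \<and>
        q = (det (columns2 x1 x2) / det (columns2 x2 x3)) *
            (det (columns2 x3 x4) / det (columns2 x4 x1)))"

definition affine_point :: "complex \<Rightarrow> (complex^2) set" where
  "affine_point z = vec.span {vector [z, 1]}"

lemma det_columns2: "det (columns2 x y) = x $ 1 * y $ 2 - y $ 1 * x $ 2"
  by (simp add: columns2_def det_2 transpose_def)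

lemma has_cr_span:
  assumes "x1 \<noteq> 0" "x2 \<noteq> 0" "x3 \<noteq> 0" "x4 \<noteq> 0"
  shows "has_cr (vec.span {x1}) (vec.span {x2}) (vec.span {x3}) (vec.span {x4}) q \<longleftrightarrow>
     det (columns2 x2 x3) \<noteq> 0 \<and> det (columns2 x4 x1) \<noteq> 0 \<and>
     q = (det (columns2 x1 x2) / det (columns2 x2 x3)) *
         (det (columns2 x3 x4) / det (columns2 x4 x1))"
    (is "?l \<longleftrightarrow> ?r")
proof
  have sc: "\<exists>c. c \<noteq> 0 \<and> y = c *s x"
    if "vec.span {x} = vec.span {y}" "y \<noteq> 0" for x y :: "complex^2"
  proof -
    have "y \<in> vec.span {x}"
      using that(1) vec.span_base[of y "{y}"] by simp
    then obtain c where "y = c *s x"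
      by (auto simp: vec.span_singleton)
    with that(2) show ?thesis by auto
  qed
  have dt: "det (columns2 (c *s x) (d *s y)) = c * d * det (columns2 x y)" for c d x y
    by (simp add: det_columns2 algebra_simps)
  assume ?l
  then obtain y1 y2 y3 y4 where y: "y1 \<noteq> 0" "y2 \<noteq> 0" "y3 \<noteq> 0" "y4 \<noteq> 0"
    "vec.span {x1} = vec.span {y1}" "vec.span {x2} = vec.span {y2}"
    "vec.span {x3} = vec.span {y3}" "vec.span {x4} = vec.span {y4}"
    and d: "det (columns2 y2 y3) \<noteq> 0" "det (columns2 y4 y1) \<noteq> 0"
    "q = (det (columns2 y1 y2) / det (columns2 y2 y3)) *
         (det (columns2 y3 y4) / det (columns2 y4 y1))"
    unfolding has_cr_def by blast
  obtain c1 where 1: "c1 \<noteq> 0" "y1 = c1 *s x1" using sc y by blast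
  obtain c2 where 2: "c2 \<noteq> 0" "y2 = c2 *s x2" using sc y by blast
  obtain c3 where 3: "c3 \<noteq> 0" "y3 = c3 *s x3" using sc y by blast
  obtain c4 where 4: "c4 \<noteq> 0" "y4 = c4 *s x4" using sc y by blast
  show ?r
    using d 1(1) 2(1) 3(1) 4(1) by (auto simp: 1(2) 2(2) 3(2) 4(2) dt)
next
  assume ?r
  then show ?l
    unfolding has_cr_def using assms by blast
qed

lemma has_cr_affine_point:
  "has_cr (affine_point z1) (affine_point z2) (affine_point z3) (affine_point z4) q \<longleftrightarrow>
     z3 \<noteq> z2 \<and> z1 \<noteq> z4 \<and> q = ((z2 - z1) / (z3 - z2)) * ((z4 - z3) / (z1 - z4))"
proof -
  have nz: "vector [z, 1] \<noteq> (0 :: complex^2)" for z :: complex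
    by (metis vector_2(2) zero_index zero_neq_one)
  have dt: "det (columns2 (vector [z, 1]) (vector [w, 1])) = - (w - z)" for z w
    by (simp add: det_columns2)
  have mm: "(- a / - b) * (- c / - d) = (a / b) * (c / d)" for a b c d :: complex
    by simp
  show ?thesis
    unfolding affine_point_def has_cr_span[OF nz nz nz nz] dt mm by auto
qed


section \<open>Discrete holomorphic maps, Darboux pairs and lifts\<close>

text \<open>A function \<open>g\<close> with complex values is discrete holomorphic if the map
  \<open>\<lambda>i. affine_point (g i)\<close> is.\<close>

definition discrete_holomorphic ::
  "'v quad_complex \<Rightarrow> ('v \<Rightarrow> (complex^2) set) \<Rightarrow> ('v \<Rightarrow> 'v \<Rightarrow> real) \<Rightarrow> bool" where
  "discrete_holomorphic S L a \<longleftrightarrow>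
     (\<forall>i \<in> verts S. L i \<in> CP1) \<and> edge_labelling S a \<and>
     (\<forall>i j k l. (i, j, k, l) \<in> faces S \<longrightarrow>
        has_cr (L i) (L j) (L k) (L l) (complex_of_real (a i j / a j k)) \<and>
        a i j / a j k \<notin> {0, 1})"

text \<open>The regularity condition, that cross ratios differ from \<open>0\<close>, \<open>1\<close> and \<open>\<infinity>\<close>, is also
  imposed on the quadrilaterals \<open>(L\<^sup>+\<^sub>i, L\<^sup>+\<^sub>j, L\<^sup>-\<^sub>j, L\<^sup>-\<^sub>i)\<close> over the edges. The value \<open>1\<close> would mean
  \<open>L\<^sup>+\<^sub>i = L\<^sup>-\<^sub>j\<close> or \<open>L\<^sup>+\<^sub>j = L\<^sup>-\<^sub>i\<close>; it is attained for some pairs that satisfy all the other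
  conditions, and these have no Weierstrass representation since the transition matrices
  have nonzero diagonal entries. The value \<open>0\<close> is only a possibility on edges without
  adjacent face.\<close>

definition darboux_pair ::
  "'v quad_complex \<Rightarrow> ('v \<Rightarrow> (complex^2) set) \<Rightarrow> ('v \<Rightarrow> (complex^2) set) \<Rightarrow> bool" where
  "darboux_pair S Lp Lm \<longleftrightarrow>
     (\<exists>\<tau> b. \<tau> \<noteq> 0 \<and> discrete_holomorphic S Lp b \<and> discrete_holomorphic S Lm b \<and>
        (\<forall>i j. (i, j) \<in> edges S \<longrightarrow>
           has_cr (Lp i) (Lp j) (Lm j) (Lm i) (complex_of_real (\<tau> * b i j)) \<and>
           \<tau> * b i j \<notin> {0, 1}))"

definition is_lift ::
  "'v quad_complex \<Rightarrow> ('v \<Rightarrow> (complex^2) set) \<Rightarrow> ('v \<Rightarrow> complex^2) \<Rightarrow> bool" where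
  "is_lift S L h \<longleftrightarrow> (\<forall>i \<in> verts S. h i \<noteq> 0 \<and> L i = vec.span {h i})"

text \<open>The transition matrix for the value \<open>s = t a\<^sub>i\<^sub>j\<close> and the difference \<open>d = dg\<^sub>i\<^sub>j\<close>;
  \<open>mat c ** M\<close> is the multiple \<open>c M\<close>.\<close>

definition weierstrass_matrix :: "real \<Rightarrow> complex \<Rightarrow> complex^2^2" where
  "weierstrass_matrix s d =
     mat (1 / csqrt (complex_of_real (1 - s))) **
     vector [vector [1, d], vector [complex_of_real s / d, 1]]"

end

theory Submission
  imports Defs
begin

text \<open>
  Write \<open>[x, y]\<close> for the determinant of the matrix with columns \<open>x, y\<close>, and normalise arbitrary
  lifts \<open>x, y\<close> of the two maps by \<open>[x\<^sub>i, y\<^sub>i] = 1\<close>, so that \<open>F = (x, y)\<close> is a frame in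
  \<open>Sl(2)\<close>. The transition matrix of \<open>F\<close> over an edge has the diagonal entries
  \<open>[x\<^sub>j, y\<^sub>i]\<close>, \<open>[x\<^sub>i, y\<^sub>j]\<close> and the off-diagonal entries \<open>[y\<^sub>j, y\<^sub>i]\<close>, \<open>[x\<^sub>i, x\<^sub>j]\<close>. With
  \<open>\<beta> = \<tau> b\<close>, the Darboux condition on the edge is \<open>[x\<^sub>i, x\<^sub>j] [y\<^sub>i, y\<^sub>j] = \<beta>\<^sub>i\<^sub>j\<close>, and by the
  Pluecker relation the product of the diagonal entries is \<open>1 - \<beta>\<^sub>i\<^sub>j\<close>.

  The normalisation leaves the gauge freedom \<open>x \<mapsto> \<lambda> x\<close>, \<open>y \<mapsto> y / \<lambda>\<close>, which scales the two
  diagonal entries by \<open>\<lambda>\<^sub>j / \<lambda>\<^sub>i\<close> and its inverse. Both of them become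
  \<open>1 / sqrt (1 - t a\<^sub>i\<^sub>j)\<close> for \<open>t a = \<beta> / (\<beta> - 1)\<close>, that is \<open>1 - t a = 1 / (1 - \<beta>)\<close>,
  if \<open>\<lambda>\<close> solves a multiplicative difference equation on the edges. On a
  simply connected complex this is possible as soon as the equation is consistent around each
  face, and there the consistency reduces to
  \<open>[x\<^sub>j, y\<^sub>i] [x\<^sub>k, y\<^sub>j] = [x\<^sub>l, y\<^sub>i] [x\<^sub>k, y\<^sub>l]\<close>: opposite edges carry the same root. This identity
  (\<open>face_diagonal_products\<close>) is the cross ratio condition for \<open>x\<close> in disguise.

  In the new gauge the upper right entry of the transition matrix, divided by the diagonal one,
  is an additive 1-form, and the product of two transition matrices along a face shows that it is
  closed. Its potential is \<open>g\<close>; the cross ratios of \<open>g\<close> are those of \<open>y\<close> up to the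
  factors \<open>1 - t a\<close>, which turn \<open>\<beta>\<^sub>i\<^sub>j / \<beta>\<^sub>j\<^sub>k\<close> into \<open>a\<^sub>i\<^sub>j / a\<^sub>j\<^sub>k\<close>. Both integrations are
  instances of the existence of parallel sections of a flat connection (\<open>parallel_section\<close>).
\<close>

section \<open>Parallel sections on simply connected complexes\<close>

fun transport :: "('v \<Rightarrow> 'v \<Rightarrow> 'x \<Rightarrow> 'x) \<Rightarrow> 'v list \<Rightarrow> 'x \<Rightarrow> 'x" where
  "transport f (i # j # p) = transport f (j # p) \<circ> f i j"
| "transport f _ = id"

lemma transport_append:
  "transport f (us @ i # vs) = transport f (i # vs) \<circ> transport f (us @ [i])"
proof (induction us)
  case (Cons u us)
  then show ?case by (cases us) (simp_all add: o_assoc)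
qed simp

lemma transport_infix_cong:
  assumes "transport f (i # p @ [j]) = transport f (i # q @ [j])"
  shows "transport f (us @ i # p @ j # vs) = transport f (us @ i # q @ j # vs)"
proof -
  have "transport f (us @ i # r @ j # vs) =
      transport f (j # vs) \<circ> transport f (i # r @ [j]) \<circ> transport f (us @ [i])" for r
    using transport_append[of f us i "r @ j # vs"] transport_append[of f "i # r" j vs] by simp
  then show ?thesis using assms by metis
qed

lemma edge_path_Cons2:
  "edge_path S (i # j # p) \<longleftrightarrow> i \<in> verts S \<and> (i, j) \<in> edges S \<and> edge_path S (j # p)"
  unfolding edge_path_def by (auto simp: nth_Cons split: nat.splits)

lemma edge_path_append:
  assumes "edge_path S p" "edge_path S q" "(last p, hd q) \<in> edges S"
  shows "edge_path S (p @ q)"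
  using assms
proof (induction p rule: induct_list012)
  case 1 then show ?case by simp
next
  case (2 i) then show ?case
    by (cases q) (auto simp: edge_path_Cons2 edge_path_def[of S "[i]"])
next
  case (3 i j p) then show ?case by (auto simp: edge_path_Cons2)
qed

lemma edge_path_singleton: "edge_path S [i] \<longleftrightarrow> i \<in> verts S"
  by (auto simp: edge_path_def)

lemma edge_path_rev:
  assumes "\<And>i j. (i, j) \<in> edges S \<Longrightarrow> (j, i) \<in> edges S" "edge_path S p"
  shows "edge_path S (rev p)"
  using assms(2)
proof (induction p rule: induct_list012)
  case (3 i j p)
  then have "edge_path S (rev (j # p) @ [i])"
    by (intro edge_path_append) (auto simp: edge_path_Cons2 edge_path_singleton assms(1))
  then show ?case by simp
qed (auto simp: edge_path_def)

text \<open>A connection that is flat, that is, trivial around the faces and along single-edge return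
  trips, has path-independent transport. The values may be restricted to a set \<open>A\<close> that the
  connection preserves. A section is obtained by transporting one value from a base point along
  chosen paths; for an edge \<open>(i, j)\<close>, the path to \<open>i\<close>, the edge, and the reversed path to \<open>j\<close> form
  a closed path, which is null-homotopic.\<close>

lemma parallel_section:
  fixes f :: "'v \<Rightarrow> 'v \<Rightarrow> 'x \<Rightarrow> 'x"
  assumes S: "quad_cell_complex S" "simply_connected_complex S"
    and inverse: "\<And>i j. (i, j) \<in> edges S \<Longrightarrow> f j i \<circ> f i j = id"
    and flat: "\<And>i j k l. (i, j, k, l) \<in> faces S \<Longrightarrow> f j k \<circ> f i j = f l k \<circ> f i l"
    and c: "c \<in> A"
    and preserves: "\<And>i j z. (i, j) \<in> edges S \<Longrightarrow> z \<in> A \<Longrightarrow> f i j z \<in> A"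
  obtains g where "\<And>i. i \<in> verts S \<Longrightarrow> g i \<in> A"
    and "\<And>i j. (i, j) \<in> edges S \<Longrightarrow> g j = f i j (g i)"
proof (cases "verts S = {}")
  case True
  then have "edges S = {}" using S(1) unfolding quad_cell_complex_def by fast
  with True that show ?thesis by blast
next
  case False
  then obtain v0 where v0: "v0 \<in> verts S" by blast
  let ?T = "transport f"
  have edge: "i \<in> verts S" "j \<in> verts S" "(j, i) \<in> edges S" if "(i, j) \<in> edges S" for i j
    using S(1) that unfolding quad_cell_complex_def by blast+
  have face: "(i, j) \<in> edges S" "(j, k) \<in> edges S" "(k, l) \<in> edges S" "(l, i) \<in> edges S"
    if "(i, j, k, l) \<in> faces S" for i j k l
    using S(1) that unfolding quad_cell_complex_def by blast+
  have inv: "f j i (f i j z) = z" if "(i, j) \<in> edges S" for i j z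
    using inverse[OF that] by (metis comp_apply id_apply)
  have flat': "f j k (f i j z) = f l k (f i l z)" if "(i, j, k, l) \<in> faces S" for i j k l z
    using flat[OF that] by (metis comp_apply)
  have move: "?T p = ?T q" if "path_move S p q" for p q
    using that
  proof cases
    case (drop_return i j us vs)
    have "?T (i # j # i # vs) = ?T (i # vs)"
      using inv[OF drop_return(3)] by (auto simp: fun_eq_iff)
    then show ?thesis
      using transport_append[of f us i "j # i # vs"] transport_append[of f us i vs] drop_return
      by simp
  next
    case (flip_1_3 i j k l us vs)
    note e = face[OF flip_1_3(3)]
    have "f i j z = f k j (f l k (f i l z))" for z
      using flat'[OF flip_1_3(3)] inv[OF e(2)] by metis
    then have "?T (i # [] @ [j]) = ?T (i # [l, k] @ [j])" by (auto simp: fun_eq_iff)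
    from transport_infix_cong[OF this] show ?thesis by (simp add: flip_1_3)
  next
    case (flip_2_2 i j k l us vs)
    have "?T (i # [j] @ [k]) = ?T (i # [l] @ [k])"
      using flat'[OF flip_2_2(3)] by (auto simp: fun_eq_iff)
    from transport_infix_cong[OF this] show ?thesis by (simp add: flip_2_2)
  next
    case (flip_3_1 i j k l us vs)
    note e = face[OF flip_3_1(3)]
    have "f k l (f j k (f i j z)) = f i l z" for z
      using flat'[OF flip_3_1(3)] inv[OF edge(3)[OF e(3)]] by metis
    then have "?T (i # [j, k] @ [l]) = ?T (i # [] @ [l])" by (auto simp: fun_eq_iff)
    from transport_infix_cong[OF this] show ?thesis by (simp add: flip_3_1)
  qed
  have homotopic: "?T p = ?T q" if "path_homotopic S p q" for p q
    using that unfolding path_homotopic_def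
    by (induction rule: equivclp_induct) (auto dest: move)
  have rev_left: "?T (rev p) (?T p z) = z" if "edge_path S p" for p z
    using that
  proof (induction p arbitrary: z rule: induct_list012)
    case (3 i j p)
    have "?T (rev (i # j # p)) = f j i \<circ> ?T (rev (j # p))"
      using transport_append[of f "rev p" j "[i]"] by simp
    with 3 show ?case by (simp add: edge_path_Cons2 inv)
  qed simp_all
  have rev_right: "?T p (?T (rev p) z) = z" if "edge_path S p" for p z
    using rev_left[of "rev p"] edge_path_rev[OF edge(3) that] by simp
  have invariant: "?T p z \<in> A" if "edge_path S p" "z \<in> A" for p z
    using that
    by (induction p arbitrary: z rule: induct_list012) (auto simp: edge_path_Cons2 preserves)
  have "\<forall>j \<in> verts S. \<exists>p. edge_path S p \<and> hd p = v0 \<and> last p = j"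
    using S(2) v0 unfolding simply_connected_complex_def by blast
  then obtain P where
    P: "\<And>j. j \<in> verts S \<Longrightarrow> edge_path S (P j) \<and> hd (P j) = v0 \<and> last (P j) = j"
    by metis
  show ?thesis
  proof (rule that)
    show "?T (P i) c \<in> A" if "i \<in> verts S" for i
      using invariant P that c by blast
  next
    fix i j assume ij: "(i, j) \<in> edges S"
    have Pi: "edge_path S (P i)" "hd (P i) = v0" "last (P i) = i" "P i \<noteq> []"
      and Pj: "edge_path S (P j)" "hd (P j) = v0" "last (P j) = j" "P j \<noteq> []"
      using P edge[OF ij] by (auto simp: edge_path_def)
    let ?q = "P i @ rev (P j)"
    have "edge_path S ?q"
      using Pi Pj ij edge_path_rev[OF edge(3) Pj(1)]
      by (intro edge_path_append) (auto simp: hd_rev)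
    moreover have "hd ?q = last ?q" using Pi Pj by (simp add: last_rev)
    ultimately have "path_homotopic S ?q [hd ?q]"
      using S(2) unfolding simply_connected_complex_def by blast
    then have "?T ?q = id" by (auto dest: homotopic)
    moreover have "?T ?q = ?T (rev (P j)) \<circ> f i j \<circ> ?T (P i)"
    proof -
      obtain us where us: "P i = us @ [i]" using Pi by (metis append_butlast_last_id)
      obtain vs where vs: "rev (P j) = j # vs"
        using Pj by (metis append_butlast_last_id rev_eq_Cons_iff rev_rev_ident)
      show ?thesis
        using transport_append[of f us i "j # vs"] unfolding us vs by (simp add: o_assoc)
    qed
    ultimately have "?T (rev (P j)) (f i j (?T (P i) c)) = c" by (metis comp_apply id_apply)
    then show "?T (P j) c = f i j (?T (P i) c)" using rev_right[OF Pj(1)] by metis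
  qed
qed

section \<open>Brackets and frames\<close>

abbreviation bracket :: "complex^2 \<Rightarrow> complex^2 \<Rightarrow> complex" where
  "bracket x y \<equiv> det (columns2 x y)"

lemma bracket_swap: "bracket y x = - bracket x y"
  by (simp add: det_columns2)

lemma bracket_scale: "bracket (c *s x) (d *s y) = c * d * bracket x y"
  by (simp add: det_columns2 algebra_simps)

text \<open>The Pluecker relation, in the form in which \<open>[u, v] = 1\<close> gives the expansion of \<open>[x, y]\<close> in the
  frame \<open>(u, v)\<close>.\<close>

lemma pluecker:
  "bracket x y * bracket u v = bracket u y * bracket x v + bracket x u * bracket y v"
  by (simp add: det_columns2 algebra_simps)

lemma span_scale:
  fixes x :: "complex^2"
  assumes "c \<noteq> 0"
  shows "vec.span {c *s x} = vec.span {x}"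
proof -
  have "k *s x \<in> range (\<lambda>k. k *s (c *s x))" for k
    using assms by (intro image_eqI[of _ _ "k / c"]) auto
  then show ?thesis by (auto simp: vec.span_singleton)
qed

lemma frame_change:
  assumes "bracket x y = 1"
  shows "columns2 x' y' = columns2 x y **
    vector [vector [bracket x' y, bracket y' y], vector [bracket x x', bracket x y']]"
proof -
  have expand: "u = bracket u y *s x + bracket x u *s y" for u
  proof -
    have "u $ n * bracket x y = bracket u y * x $ n + bracket x u * y $ n" for n :: 2
      using exhaust_2[of n] by (auto simp: det_columns2 algebra_simps)
    then show ?thesis unfolding assms by (simp add: vec_eq_iff)
  qed
  have columns: "columns2 u v = (\<chi> n m. if m = 1 then u $ n else v $ n)" for u v
    by (simp add: columns2_def transpose_def vec_eq_iff forall_2)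
  have "columns2 (p *s x + q *s y) (r *s x + s *s y) =
      columns2 x y ** vector [vector [p, r], vector [q, s]]" for p q r s
    by (simp add: columns matrix_matrix_mult_def vec_eq_iff forall_2 sum_2 mult.commute)
  from this[of "bracket x' y" "bracket x x'" "bracket y' y" "bracket x y'"] show ?thesis
    using expand[of x'] expand[of y'] by argo
qed

text \<open>By \<open>pluecker\<close>, expanding \<open>[x\<^sub>k, y\<^sub>i]\<close> in the frames at \<open>j\<close> and \<open>l\<close> gives the two sides up to
  \<open>[x\<^sub>k, x\<^sub>j] [y\<^sub>i, y\<^sub>j]\<close> and \<open>[x\<^sub>k, x\<^sub>l] [y\<^sub>i, y\<^sub>l]\<close>; the edge conditions turn the equality of
  these two terms into the cross ratio condition.\<close>

lemma face_diagonal_products: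
  assumes "bracket xj yj = 1" "bracket xl yl = 1"
    and ij: "bracket xi xj * bracket yi yj = \<beta>" "\<beta> \<noteq> 0"
    and il: "bracket xi xl * bracket yi yl = \<gamma>" "\<gamma> \<noteq> 0"
    and cr: "bracket xi xj * bracket xk xl * \<gamma> = \<beta> * (bracket xj xk * bracket xl xi)"
  shows "bracket xj yi * bracket xk yj = bracket xl yi * bracket xk yl"
proof -
  let ?A = "bracket xi xj" and ?B = "bracket xi xl"
  have "?A \<noteq> 0" "?B \<noteq> 0" using ij il by auto
  have "?A * bracket xk xl * \<gamma> = \<beta> * (bracket xk xj * ?B)"
    using cr bracket_swap[of xk xj] bracket_swap[of xi xl] by simp
  then have "?A * ?B * (bracket xk xj * bracket yi yj) = ?A * ?B * (bracket xk xl * bracket yi yl)"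
    unfolding ij(1)[symmetric] il(1)[symmetric] by (auto simp: mult_ac)
  then have "bracket xk xj * bracket yi yj = bracket xk xl * bracket yi yl"
    using \<open>?A \<noteq> 0\<close> \<open>?B \<noteq> 0\<close> by (metis mult_eq_0_iff mult_left_cancel)
  then show ?thesis
    using pluecker[of xk yi xj yj] pluecker[of xk yi xl yl] assms(1,2) by simp
qed

section \<open>The Weierstrass representation\<close>

text \<open>The cross ratio conditions of a Darboux pair in terms of lifts with determinant 1, with all
  denominators cleared and with \<open>\<beta> = \<tau> b\<close> in place of \<open>b\<close>; the face cross ratios only depend on
  quotients of the labels.\<close>

definition normalised_lifts ::
  "'v quad_complex \<Rightarrow> ('v \<Rightarrow> 'v \<Rightarrow> real) \<Rightarrow> ('v \<Rightarrow> complex^2) \<Rightarrow> ('v \<Rightarrow> complex^2) \<Rightarrow> bool" where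
  "normalised_lifts S \<beta> x y \<longleftrightarrow>
     (\<forall>i \<in> verts S. bracket (x i) (y i) = 1) \<and>
     (\<forall>i j. (i, j) \<in> edges S \<longrightarrow>
        bracket (x i) (x j) * bracket (y i) (y j) = complex_of_real (\<beta> i j) \<and>
        \<beta> i j \<noteq> 0 \<and> \<beta> i j \<noteq> 1) \<and>
     edge_labelling S \<beta> \<and>
     (\<forall>i j k l. (i, j, k, l) \<in> faces S \<longrightarrow> \<beta> i j \<noteq> \<beta> j k \<and>
        (\<forall>z \<in> {x, y}. bracket (z i) (z j) * bracket (z k) (z l) * complex_of_real (\<beta> j k) =
          complex_of_real (\<beta> i j) * (bracket (z j) (z k) * bracket (z l) (z i))))"

lemma is_lift_scale:
  assumes "is_lift S L h" "\<And>i. i \<in> verts S \<Longrightarrow> c i \<noteq> 0"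
  shows "is_lift S L (\<lambda>i. c i *s h i)"
  using assms unfolding is_lift_def by (auto simp: span_scale)

lemma has_cr_lift:
  assumes "has_cr L1 L2 L3 L4 q"
    and "x1 \<noteq> 0 \<and> L1 = vec.span {x1}" "x2 \<noteq> 0 \<and> L2 = vec.span {x2}"
    and "x3 \<noteq> 0 \<and> L3 = vec.span {x3}" "x4 \<noteq> 0 \<and> L4 = vec.span {x4}"
  shows "bracket x2 x3 \<noteq> 0" "bracket x4 x1 \<noteq> 0"
    and "bracket x1 x2 * bracket x3 x4 = q * (bracket x2 x3 * bracket x4 x1)"
  using assms has_cr_span[of x1 x2 x3 x4 q] by auto

lemma exists_lift:
  assumes "\<And>i. i \<in> verts S \<Longrightarrow> L i \<in> CP1"
  obtains h where "is_lift S L h"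
proof -
  have "\<forall>i \<in> verts S. \<exists>x. x \<noteq> 0 \<and> L i = vec.span {x}"
    using assms unfolding CP1_def by blast
  from bchoice[OF this] that show thesis unfolding is_lift_def by blast
qed

text \<open>The normalisation needs \<open>L\<^sup>+\<^sub>i \<noteq> L\<^sup>-\<^sub>i\<close>, which is part of the cross ratio condition on any
  edge at \<open>i\<close>; there is one because the complex has no isolated vertices.\<close>

lemma darboux_pair_normalised_lifts:
  assumes S: "quad_cell_complex S" and darboux: "darboux_pair S Lp Lm"
  obtains \<beta> x y where "is_lift S Lp x" "is_lift S Lm y" "normalised_lifts S \<beta> x y"
proof -
  obtain \<tau> b where \<tau>: "\<tau> \<noteq> 0" and hol: "discrete_holomorphic S Lp b" "discrete_holomorphic S Lm b"
    and e: "\<And>i j. (i, j) \<in> edges S \<Longrightarrow>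
      has_cr (Lp i) (Lp j) (Lm j) (Lm i) (complex_of_real (\<tau> * b i j)) \<and> \<tau> * b i j \<notin> {0, 1}"
    using darboux unfolding darboux_pair_def by blast
  obtain x where x: "is_lift S Lp x"
    using hol(1) exists_lift unfolding discrete_holomorphic_def by metis
  obtain y' where y': "is_lift S Lm y'"
    using hol(2) exists_lift unfolding discrete_holomorphic_def by metis
  have edge: "i \<in> verts S" "j \<in> verts S" if "(i, j) \<in> edges S" for i j
    using S that unfolding quad_cell_complex_def by blast+
  have face: "(i, j) \<in> edges S" "(j, k) \<in> edges S" "(k, l) \<in> edges S" "(l, i) \<in> edges S"
    if "(i, j, k, l) \<in> faces S" for i j k l
    using S that unfolding quad_cell_complex_def by blast+
  have transversal: "bracket (x i) (y' i) \<noteq> 0" if i: "i \<in> verts S" for i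
  proof -
    obtain j where ij: "(i, j) \<in> edges S"
      using S i unfolding quad_cell_complex_def by blast
    have "bracket (y' i) (x i) \<noteq> 0"
      using has_cr_lift(2)[of "Lp i" "Lp j" "Lm j" "Lm i" _ "x i" "x j" "y' j" "y' i"]
        e[OF ij] x y' edge[OF ij] unfolding is_lift_def by blast
    then show ?thesis using bracket_swap[of "y' i" "x i"] by simp
  qed
  define y where "y i = (1 / bracket (x i) (y' i)) *s y' i" for i
  have y: "is_lift S Lm y"
    unfolding y_def by (rule is_lift_scale[OF y']) (simp add: transversal)
  have det: "bracket (x i) (y i) = 1" if "i \<in> verts S" for i
    using bracket_scale[of 1 "x i"] transversal[OF that] by (simp add: y_def)
  let ?\<beta> = "\<lambda>i j. \<tau> * b i j"
  have edges: "bracket (x i) (x j) * bracket (y i) (y j) = complex_of_real (?\<beta> i j)"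
    if ij: "(i, j) \<in> edges S" for i j
  proof -
    have "bracket (x i) (x j) * bracket (y j) (y i) =
        complex_of_real (?\<beta> i j) * (bracket (x j) (y j) * bracket (y i) (x i))"
      using has_cr_lift(3)[of "Lp i" "Lp j" "Lm j" "Lm i" _ "x i" "x j" "y j" "y i"]
        e[OF ij] x y edge[OF ij] unfolding is_lift_def by blast
    then show ?thesis
      using det edge[OF ij] bracket_swap[of "y i" "x i"] bracket_swap[of "y j" "y i"] by simp
  qed
  have cr: "bracket (z i) (z j) * bracket (z k) (z l) * complex_of_real (?\<beta> j k) =
      complex_of_real (?\<beta> i j) * (bracket (z j) (z k) * bracket (z l) (z i))"
    if f: "(i, j, k, l) \<in> faces S" and z: "is_lift S L z" and h: "discrete_holomorphic S L b"
    for i j k l z L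
  proof -
    have "b j k \<noteq> 0" using e face(2)[OF f] by auto
    moreover have "bracket (z i) (z j) * bracket (z k) (z l) =
        complex_of_real (b i j / b j k) * (bracket (z j) (z k) * bracket (z l) (z i))"
      using has_cr_lift(3)[of "L i" "L j" "L k" "L l" _ "z i" "z j" "z k" "z l"]
        h f z face[OF f] edge unfolding is_lift_def discrete_holomorphic_def by blast
    ultimately show ?thesis by simp
  qed
  have "?\<beta> i j \<noteq> ?\<beta> j k" if f: "(i, j, k, l) \<in> faces S" for i j k l
    using hol(1) f \<tau> unfolding discrete_holomorphic_def by fastforce
  moreover have "edge_labelling S ?\<beta>"
    using hol(1) unfolding discrete_holomorphic_def edge_labelling_def by metis
  ultimately have "normalised_lifts S ?\<beta> x y"
    unfolding normalised_lifts_def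
  proof (intro conjI allI impI ballI)
    show "?\<beta> i j \<noteq> 0" "?\<beta> i j \<noteq> 1" if "(i, j) \<in> edges S" for i j
      using e[OF that] by blast+
    show "bracket (z i) (z j) * bracket (z k) (z l) * complex_of_real (?\<beta> j k) =
        complex_of_real (?\<beta> i j) * (bracket (z j) (z k) * bracket (z l) (z i))"
      if "(i, j, k, l) \<in> faces S" "z \<in> {x, y}" for i j k l z
      using cr[OF that(1) x hol(1)] cr[OF that(1) y hol(2)] that(2) by blast
  qed (use det edges in blast)+
  with x y that show thesis by blast
qed

text \<open>The product of the diagonal entries of a transition matrix is \<open>1 - \<beta>\<^sub>i\<^sub>j\<close> in every gauge,
  so that equal entries must be square roots of it. Integrating the ratios \<open>c\<^sub>j / c\<^sub>i\<close> themselves,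
  instead of extracting a root of quotients of diagonal entries at each vertex, leaves no signs to
  be adjusted: every entry is the reciprocal of the principal root of \<open>1 / (1 - \<beta>\<^sub>i\<^sub>j)\<close>.\<close>

lemma equal_diagonal_gauge:
  assumes S: "quad_cell_complex S" "simply_connected_complex S"
    and norm: "normalised_lifts S \<beta> x y"
  defines "s \<equiv> \<lambda>i j. csqrt (complex_of_real (1 / (1 - \<beta> i j)))"
  obtains c where "\<And>i. i \<in> verts S \<Longrightarrow> c i \<noteq> 0"
    and "\<And>i j. (i, j) \<in> edges S \<Longrightarrow> bracket (c j *s x j) ((1 / c i) *s y i) = 1 / s i j"
    and "\<And>i j. (i, j) \<in> edges S \<Longrightarrow> bracket (c i *s x i) ((1 / c j) *s y j) = 1 / s i j"
proof -
  have edge: "i \<in> verts S" "j \<in> verts S" "(j, i) \<in> edges S" if "(i, j) \<in> edges S" for i j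
    using S that unfolding quad_cell_complex_def by blast+
  have face: "(i, j) \<in> edges S" "(j, k) \<in> edges S" "(k, l) \<in> edges S" "(l, i) \<in> edges S"
    if "(i, j, k, l) \<in> faces S" for i j k l
    using S that unfolding quad_cell_complex_def by blast+
  have det: "bracket (x i) (y i) = 1" if "i \<in> verts S" for i
    using norm that unfolding normalised_lifts_def by blast
  have \<beta>: "bracket (x i) (x j) * bracket (y i) (y j) = complex_of_real (\<beta> i j)"
    "\<beta> i j \<noteq> 0" "\<beta> i j \<noteq> 1" "\<beta> i j = \<beta> j i" if "(i, j) \<in> edges S" for i j
    using norm that unfolding normalised_lifts_def edge_labelling_def by blast+
  have opposite: "\<beta> i j = \<beta> k l" if "(i, j, k, l) \<in> faces S" for i j k l
    using norm that unfolding normalised_lifts_def edge_labelling_def by blast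
  define m where "m i j = 1 / (s i j * bracket (x j) (y i))" for i j
  have s_sym: "s i j = s j i" if "(i, j) \<in> edges S" for i j
    using \<beta>(4)[OF that] by (simp add: s_def)
  have s_square: "s i j * s i j * complex_of_real (1 - \<beta> i j) = 1" if "(i, j) \<in> edges S" for i j
  proof -
    have "s i j * s i j = complex_of_real (1 / (1 - \<beta> i j))"
      unfolding s_def by (metis power2_csqrt power2_eq_square)
    then show ?thesis using \<beta>(3)[OF that] by (simp flip: of_real_mult)
  qed
  have diag: "bracket (x j) (y i) * bracket (x i) (y j) = complex_of_real (1 - \<beta> i j)"
    if ij: "(i, j) \<in> edges S" for i j
    using pluecker[of "x j" "y i" "x i" "y j"] det edge[OF ij] \<beta>(1)[OF ij]
      bracket_swap[of "x j" "x i"] by simp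
  have m_inverse: "m j i * m i j = 1" if ij: "(i, j) \<in> edges S" for i j
  proof -
    have "m j i * m i j = 1 / (s i j * s i j * (bracket (x j) (y i) * bracket (x i) (y j)))"
      unfolding m_def s_sym[OF edge(3)[OF ij]] by simp
    then show ?thesis using s_square[OF ij] diag[OF ij] by simp
  qed
  have m_flat: "m j k * m i j = m l k * m i l" if f: "(i, j, k, l) \<in> faces S" for i j k l
  proof -
    note e = face[OF f]
    have f': "(j, k, l, i) \<in> faces S" using S(1) f unfolding quad_cell_complex_def by blast
    have li: "(i, l) \<in> edges S" "\<beta> i l = \<beta> j k" and lk: "\<beta> l k = \<beta> i j"
      using edge(3)[OF e(4)] \<beta>(4)[OF e(4)] \<beta>(4)[OF e(3)] opposite[OF f] opposite[OF f'] by simp_all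
    have cr: "bracket (x i) (x j) * bracket (x k) (x l) * complex_of_real (\<beta> j k) =
        complex_of_real (\<beta> i j) * (bracket (x j) (x k) * bracket (x l) (x i))"
      using norm f unfolding normalised_lifts_def by blast
    have "bracket (x j) (y i) * bracket (x k) (y j) = bracket (x l) (y i) * bracket (x k) (y l)"
      by (rule face_diagonal_products[where xi = "x i" and \<beta> = "complex_of_real (\<beta> i j)"
            and \<gamma> = "complex_of_real (\<beta> j k)"])
        (use det edge \<beta> e li cr in auto)
    moreover have "s j k * s i j = s l k * s i l"
      using li lk by (simp add: s_def)
    ultimately show ?thesis unfolding m_def by (simp add: mult_ac)
  qed
  obtain c where c: "\<And>i. i \<in> verts S \<Longrightarrow> c i \<in> - {0}"
    and step: "\<And>i j. (i, j) \<in> edges S \<Longrightarrow> c j = m i j * c i"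
  proof (rule parallel_section[OF S, where f = "\<lambda>i j z. m i j * z" and A = "- {0}" and c = 1])
    show "(\<lambda>z. m j i * z) \<circ> (\<lambda>z. m i j * z) = id" if "(i, j) \<in> edges S" for i j
      using m_inverse[OF that] by (simp add: fun_eq_iff mult.assoc[symmetric])
    show "(\<lambda>z. m j k * z) \<circ> (\<lambda>z. m i j * z) = (\<lambda>z. m l k * z) \<circ> (\<lambda>z. m i l * z)"
      if "(i, j, k, l) \<in> faces S" for i j k l
      using m_flat[OF that] by (simp add: fun_eq_iff mult.assoc[symmetric])
    show "m i j * z \<in> - {0}" if "(i, j) \<in> edges S" "z \<in> - {0}" for i j z
      using m_inverse[OF that(1)] that(2) by auto
  qed auto
  have upper: "bracket (c j *s x j) ((1 / c i) *s y i) = 1 / s i j" if ij: "(i, j) \<in> edges S" for i j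
  proof -
    have "c i \<noteq> 0" using c edge[OF ij] by simp
    moreover have "m i j \<noteq> 0" using m_inverse[OF ij] by auto
    then have "m i j * bracket (x j) (y i) = 1 / s i j" unfolding m_def by simp
    ultimately show ?thesis unfolding bracket_scale step[OF ij] by simp
  qed
  show thesis
  proof (rule that)
    show "bracket (c i *s x i) ((1 / c j) *s y j) = 1 / s i j" if ij: "(i, j) \<in> edges S" for i j
      using upper[OF edge(3)[OF ij]] s_sym[OF ij] by simp
  qed (use c upper in auto)
qed

lemma normalised_lifts_gauge:
  assumes S: "quad_cell_complex S" and norm: "normalised_lifts S \<beta> x y"
    and c: "\<And>i. i \<in> verts S \<Longrightarrow> c i \<noteq> 0"
  shows "normalised_lifts S \<beta> (\<lambda>i. c i *s x i) (\<lambda>i. (1 / c i) *s y i)"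
proof -
  have edge: "i \<in> verts S" "j \<in> verts S" if "(i, j) \<in> edges S" for i j
    using S that unfolding quad_cell_complex_def by blast+
  have cr: "bracket (d i *s z i) (d j *s z j) * bracket (d k *s z k) (d l *s z l) * q =
      r * (bracket (d j *s z j) (d k *s z k) * bracket (d l *s z l) (d i *s z i))"
    if "bracket (z i) (z j) * bracket (z k) (z l) * q =
      r * (bracket (z j) (z k) * bracket (z l) (z i))"
    for i j k l q r and d :: "'a \<Rightarrow> complex" and z
  proof -
    have "bracket (d i *s z i) (d j *s z j) * bracket (d k *s z k) (d l *s z l) * q =
        d i * d j * d k * d l * (bracket (z i) (z j) * bracket (z k) (z l) * q)"
      by (simp add: bracket_scale)
    also have "\<dots> = r * (bracket (d j *s z j) (d k *s z k) * bracket (d l *s z l) (d i *s z i))"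
      unfolding that by (simp add: bracket_scale)
    finally show ?thesis .
  qed
  have "bracket (c i *s x i) (c j *s x j) * bracket ((1 / c i) *s y i) ((1 / c j) *s y j) =
      bracket (x i) (x j) * bracket (y i) (y j)" if "(i, j) \<in> edges S" for i j
    using c[OF edge(1)[OF that]] c[OF edge(2)[OF that]] by (simp add: bracket_scale)
  moreover have "bracket (c i *s x i) ((1 / c i) *s y i) = bracket (x i) (y i)"
    if "i \<in> verts S" for i
    using c[OF that] by (simp add: bracket_scale)
  ultimately show ?thesis
    using norm cr[where z = x and d = c] cr[where z = y and d = "\<lambda>i. 1 / c i"]
    unfolding normalised_lifts_def ball_simps by (simp del: of_real_eq_iff)
qed

lemma weierstrass_matrix_entries:
  assumes "s = csqrt (complex_of_real (1 - r))"
  shows "weierstrass_matrix r d =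
    vector [vector [1 / s, d / s], vector [complex_of_real r / (d * s), 1 / s]]"
  unfolding weierstrass_matrix_def assms
  by (simp add: vec_eq_iff forall_2 matrix_matrix_mult_def mat_def sum_2)

theorem mainTheorem1:
  fixes S :: "'v quad_complex"
    and Lp Lm :: "'v \<Rightarrow> (complex^2) set"
  assumes "quad_cell_complex S"
    and "simply_connected_complex S"
    and "darboux_pair S Lp Lm"
  shows "\<exists>(g :: 'v \<Rightarrow> complex) (a :: 'v \<Rightarrow> 'v \<Rightarrow> real) (t :: real)
            (hp :: 'v \<Rightarrow> complex^2) (hm :: 'v \<Rightarrow> complex^2).
     discrete_holomorphic S (\<lambda>i. affine_point (g i)) a \<and>
     t \<noteq> 0 \<and> (\<forall>i j. (i, j) \<in> edges S \<longrightarrow> t \<noteq> 1 / a i j) \<and>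
     is_lift S Lp hp \<and> is_lift S Lm hm \<and>
     (\<forall>i \<in> verts S. det (columns2 (hp i) (hm i)) = 1) \<and>
     (\<forall>i j. (i, j) \<in> edges S \<longrightarrow> g j - g i \<noteq> 0 \<and>
        columns2 (hp j) (hm j) =
          columns2 (hp i) (hm i) ** weierstrass_matrix (t * a i j) (g j - g i))"
proof -
  note S = assms(1,2)
  obtain \<beta> x0 y0 where lift0: "is_lift S Lp x0" "is_lift S Lm y0"
    and norm0: "normalised_lifts S \<beta> x0 y0"
    using darboux_pair_normalised_lifts assms by metis
  define s where "s i j = csqrt (complex_of_real (1 / (1 - \<beta> i j)))" for i j
  obtain c where c: "\<And>i. i \<in> verts S \<Longrightarrow> c i \<noteq> 0"
    and c_diag: "\<And>i j. (i, j) \<in> edges S \<Longrightarrow> bracket (c j *s x0 j) ((1 / c i) *s y0 i) = 1 / s i j"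
    "\<And>i j. (i, j) \<in> edges S \<Longrightarrow> bracket (c i *s x0 i) ((1 / c j) *s y0 j) = 1 / s i j"
    using equal_diagonal_gauge[OF S norm0] unfolding s_def by blast
  define x y where "x i = c i *s x0 i" and "y i = (1 / c i) *s y0 i" for i
  have lift: "is_lift S Lp x" "is_lift S Lm y"
    unfolding x_def y_def by (intro is_lift_scale lift0; use c in simp)+
  have norm: "normalised_lifts S \<beta> x y"
    unfolding x_def y_def by (rule normalised_lifts_gauge[OF S(1) norm0 c])
  have diag: "bracket (x j) (y i) = 1 / s i j" "bracket (x i) (y j) = 1 / s i j"
    if "(i, j) \<in> edges S" for i j
    using c_diag that unfolding x_def y_def by blast+
  have edge: "i \<in> verts S" "j \<in> verts S" "(j, i) \<in> edges S" if "(i, j) \<in> edges S" for i j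
    using S that unfolding quad_cell_complex_def by blast+
  have face: "(i, j) \<in> edges S" "(j, k) \<in> edges S" "(k, l) \<in> edges S" "(l, i) \<in> edges S"
    "(j, k, l, i) \<in> faces S"
    if "(i, j, k, l) \<in> faces S" for i j k l
    using S that unfolding quad_cell_complex_def by blast+
  have det: "bracket (x i) (y i) = 1" if "i \<in> verts S" for i
    using norm that unfolding normalised_lifts_def by blast
  have \<beta>: "bracket (x i) (x j) * bracket (y i) (y j) = complex_of_real (\<beta> i j)"
    "\<beta> i j \<noteq> 0" "\<beta> i j \<noteq> 1" "\<beta> i j = \<beta> j i" if "(i, j) \<in> edges S" for i j
    using norm that unfolding normalised_lifts_def edge_labelling_def by blast+
  have opposite: "\<beta> i j = \<beta> k l" if "(i, j, k, l) \<in> faces S" for i j k l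
    using norm that unfolding normalised_lifts_def edge_labelling_def by blast
  have s_square: "s i j * s i j = complex_of_real (1 / (1 - \<beta> i j))" for i j
    unfolding s_def by (metis power2_csqrt power2_eq_square)
  have s_nonzero: "s i j \<noteq> 0" if "(i, j) \<in> edges S" for i j
    using \<beta>(3)[OF that] by (simp add: s_def)
  have s_sym: "s j i = s i j" if "(i, j) \<in> edges S" for i j
    using \<beta>(4)[OF that] by (simp add: s_def)
  define d where "d i j = s i j * bracket (y j) (y i)" for i j
  have d_bracket: "bracket (y j) (y i) = d i j / s i j" if "(i, j) \<in> edges S" for i j
    using s_nonzero[OF that] by (simp add: d_def)
  have d_nonzero: "d i j \<noteq> 0" if "(i, j) \<in> edges S" for i j
    using \<beta>(1,2)[OF that] s_nonzero[OF that] bracket_swap[of "y i" "y j"] by (auto simp: d_def)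
  have d_swap: "d j i = - d i j" if "(i, j) \<in> edges S" for i j
    using s_sym[OF that] bracket_swap[of "y i" "y j"] by (simp add: d_def)
  \<comment> \<open>The expansion of \<open>[y\<^sub>k, y\<^sub>i]\<close> in the frame at \<open>j\<close> is the upper right entry of a product of
    two transition matrices. Its denominator is the same along \<open>i, j, k\<close> and along \<open>i, l, k\<close>,
    because opposite edges of a face have equal labels; hence \<open>d\<close> is closed.\<close>
  have diagonal: "bracket (y k) (y i) = (d i j + d j k) / (s i j * s j k)"
    if ij: "(i, j) \<in> edges S" and jk: "(j, k) \<in> edges S" for i j k
  proof -
    have "bracket (y k) (y i) = bracket (x j) (y i) * bracket (y k) (y j)
        + bracket (y k) (x j) * bracket (y i) (y j)"
      using pluecker[of "y k" "y i" "x j" "y j"] det edge[OF ij] by simp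
    also have "\<dots> = (1 / s i j) * (d j k / s j k) + (1 / s j k) * (d i j / s i j)"
      using diag[OF ij] diag[OF jk] d_bracket[OF ij] d_bracket[OF jk]
        bracket_swap[of "y k" "x j"] bracket_swap[of "y i" "y j"] by simp
    finally show ?thesis by (simp add: add_divide_distrib mult_ac)
  qed
  have d_closed: "d i j + d j k = d i l + d l k" if f: "(i, j, k, l) \<in> faces S" for i j k l
  proof -
    note e = face[OF f]
    have "s i l = s j k" "s l k = s i j"
      using \<beta>(4)[OF e(4)] \<beta>(4)[OF e(3)] opposite[OF f] opposite[OF e(5)] by (simp_all add: s_def)
    then show ?thesis
      using diagonal[OF e(1,2)] diagonal[OF edge(3)[OF e(4)] edge(3)[OF e(3)]]
        s_nonzero[OF e(1)] s_nonzero[OF e(2)] by (simp add: mult.commute)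
  qed
  obtain g where g: "\<And>i j. (i, j) \<in> edges S \<Longrightarrow> g j = g i + d i j"
  proof (rule parallel_section[OF S, where f = "\<lambda>i j z. z + d i j" and A = UNIV and c = 0])
    show "(\<lambda>z. z + d j i) \<circ> (\<lambda>z. z + d i j) = id" if "(i, j) \<in> edges S" for i j
      using d_swap[OF that] by (simp add: fun_eq_iff)
    show "(\<lambda>z. z + d j k) \<circ> (\<lambda>z. z + d i j) = (\<lambda>z. z + d l k) \<circ> (\<lambda>z. z + d i l)"
      if "(i, j, k, l) \<in> faces S" for i j k l
      using d_closed[OF that] by (simp add: fun_eq_iff add.assoc)
  qed blast+
  have dg: "g j - g i = d i j" if "(i, j) \<in> edges S" for i j
    using g[OF that] by simp
  \<comment> \<open>Only the products \<open>t a\<close> matter, so \<open>t = 1\<close> can be chosen.\<close>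
  define a where "a i j = \<beta> i j / (\<beta> i j - 1)" for i j
  have one_minus_a: "1 - a i j = 1 / (1 - \<beta> i j)" if "(i, j) \<in> edges S" for i j
    using \<beta>(3)[OF that] by (simp add: a_def divide_simps)
  have a_\<beta>: "complex_of_real (a i j) = - (s i j * s i j * complex_of_real (\<beta> i j))"
    if "(i, j) \<in> edges S" for i j
  proof -
    have "a i j = - (1 / (1 - \<beta> i j) * \<beta> i j)"
      using \<beta>(3)[OF that] by (simp add: a_def divide_simps algebra_simps)
    then show ?thesis unfolding s_square by (simp only: of_real_mult of_real_minus)
  qed
  have a_nonzero: "a i j \<noteq> 0" "a i j \<noteq> 1" if "(i, j) \<in> edges S" for i j
    using \<beta>(2,3)[OF that] by (simp_all add: a_def divide_simps)
  have transition: "columns2 (x j) (y j) =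
      columns2 (x i) (y i) ** weierstrass_matrix (a i j) (g j - g i)" if ij: "(i, j) \<in> edges S" for i j
  proof -
    have "complex_of_real (a i j) = bracket (x i) (x j) * (d i j * s i j)"
      unfolding a_\<beta>[OF ij] \<beta>(1)[OF ij, symmetric] d_def bracket_swap[of "y j" "y i"]
      by simp
    then have "bracket (x i) (x j) = complex_of_real (a i j) / (d i j * s i j)"
      using d_nonzero[OF ij] s_nonzero[OF ij] by simp
    moreover have "s i j = csqrt (complex_of_real (1 - a i j))"
      unfolding one_minus_a[OF ij] s_def ..
    ultimately show ?thesis
      using frame_change[OF det[OF edge(1)[OF ij]], of "x j" "y j"]
        weierstrass_matrix_entries[of "s i j" "a i j" "d i j"]
      unfolding dg[OF ij] by (simp add: diag[OF ij] d_bracket[OF ij])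
  qed
  have "has_cr (affine_point (g i)) (affine_point (g j)) (affine_point (g k)) (affine_point (g l))
      (complex_of_real (a i j / a j k))" and "a i j / a j k \<notin> {0, 1}"
    if f: "(i, j, k, l) \<in> faces S" for i j k l
  proof -
    note e = face[OF f]
    have ss: "s k l = s i j" "s l i = s j k"
      using opposite[OF f] opposite[OF e(5)] by (simp_all add: s_def)
    have cr: "bracket (y i) (y j) * bracket (y k) (y l) * complex_of_real (\<beta> j k) =
        complex_of_real (\<beta> i j) * (bracket (y j) (y k) * bracket (y l) (y i))"
      using norm f unfolding normalised_lifts_def by blast
    have d_eq: "d u v = - (s u v * bracket (y u) (y v))" for u v
      unfolding d_def bracket_swap[of "y v" "y u"] by simp
    have "d i j * d k l * complex_of_real (a j k) = - (s i j * s i j * s j k * s j k) *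
        (bracket (y i) (y j) * bracket (y k) (y l) * complex_of_real (\<beta> j k))"
      unfolding a_\<beta>[OF e(2)] d_eq ss by (simp add: mult_ac)
    also have "\<dots> = complex_of_real (a i j) * (d j k * d l i)"
      unfolding cr a_\<beta>[OF e(1)] d_eq ss by (simp add: mult_ac)
    finally have "d i j * d k l * complex_of_real (a j k) =
        complex_of_real (a i j) * (d j k * d l i)" .
    then have "complex_of_real (a i j / a j k) = (d i j / d j k) * (d k l / d l i)"
      using d_nonzero[OF e(2)] d_nonzero[OF e(4)] a_nonzero[OF e(2)] by (simp add: divide_simps mult_ac)
    then show "has_cr (affine_point (g i)) (affine_point (g j)) (affine_point (g k))
        (affine_point (g l)) (complex_of_real (a i j / a j k))"
      using dg[OF e(1)] dg[OF e(2)] dg[OF e(3)] dg[OF e(4)] d_nonzero[OF e(2)] d_nonzero[OF e(4)]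
      unfolding has_cr_affine_point by auto
    have "\<beta> i j \<noteq> \<beta> j k" using norm f unfolding normalised_lifts_def by blast
    then have "1 - a i j \<noteq> 1 - a j k"
      unfolding one_minus_a[OF e(1)] one_minus_a[OF e(2)] by simp
    then show "a i j / a j k \<notin> {0, 1}" using a_nonzero e by auto
  qed
  moreover have "affine_point z \<in> CP1" for z
  proof -
    have "(vector [z, 1] :: complex^2) \<noteq> 0" by (metis vector_2(2) zero_index zero_neq_one)
    then show ?thesis unfolding affine_point_def CP1_def by blast
  qed
  moreover have "edge_labelling S a"
    using norm unfolding normalised_lifts_def edge_labelling_def a_def by metis
  ultimately have hol: "discrete_holomorphic S (\<lambda>i. affine_point (g i)) a"
    unfolding discrete_holomorphic_def by blast
  have regular: "1 \<noteq> 1 / a i j" if "(i, j) \<in> edges S" for i j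
    using a_nonzero[OF that] by (auto simp: divide_simps)
  show ?thesis
  proof (rule exI[of _ g], rule exI[of _ a], rule exI[of _ 1], rule exI[of _ x],
      rule exI[of _ y], intro conjI allI impI ballI)
    show "g j - g i \<noteq> 0" if "(i, j) \<in> edges S" for i j
      using d_nonzero[OF that] unfolding dg[OF that] .
    show "columns2 (x j) (y j) = columns2 (x i) (y i) ** weierstrass_matrix (1 * a i j) (g j - g i)"
      if "(i, j) \<in> edges S" for i j
      unfolding mult_1_left by (rule transition[OF that])
    show "1 \<noteq> 1 / a i j" if "(i, j) \<in> edges S" for i j by (rule regular[OF that])
  qed (rule hol lift det zero_neq_one[symmetric] | assumption)+
qed

end
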